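(* Let $A$ be a nonsingular $n\times n$ matrix. Let $M=[\mathbf{m}_1,\mathbf{m}_2,\ldots,\mathbf{m}_n]$ be an $n\times n$ matrix satisfying $\|A\mathbf{m}_k-\mathbf{e}_k\|_2\le\varepsilon<0.5$ for $k=1,2,\ldots,n$, and let $M_d=M-F=[\mathbf{m}_1^d,\mathbf{m}_2^d,\ldots,\mathbf{m}_n^d]$ with $F=[\mathbf{f}_1,\mathbf{f}_2,\ldots,\mathbf{f}_n]$ an $n\times n$ matrix. If $$\|\mathbf{f}_k\|_1\le\frac{\varepsilon}{\|A\|_1},\quad k=1,2,\ldots,n,$$ then $$\|A\mathbf{m}_k^d-\mathbf{e}_k\|_2\le 2\varepsilon,\quad k=1,2,\ldots,n.$$
   Context: Matrices and vectors are real or complex. $\mathbf{e}_k$ is the $k$th column of the $n\times n$ identity matrix. $[\mathbf{m}_1,\ldots,\mathbf{m}_n]$ denotes the matrix with columns $\mathbf{m}_1,\ldots,\mathbf{m}_n$, and similarly for $M_d$ and $F$. For vectors, $\|\cdot\|_1$ and $\|\cdot\|_2$ are the usual 1-norm and Euclidean norm; $\|A\|_1$ is the matrix norm induced by the vector 1-norm (maximum absolute column sum). *)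

theory Defs
  imports "HOL-Analysis.Analysis"
begin

(* The scalar class real_normed_field has the instances real and complex, so a statement
   polymorphic in it covers the real and the complex case at once.  The Euclidean norm of
   a vector is the library norm, which on 'a ^ 'n is L2_set (\<lambda>i. norm (x $ i)) UNIV. *)

definition vec_norm1 :: "'a::real_normed_field ^ 'n \<Rightarrow> real" where
  "vec_norm1 x = (\<Sum>i\<in>UNIV. norm (x $ i))"

definition mat_norm1 :: "'a::real_normed_field ^ 'n ^ 'm \<Rightarrow> real" where
  "mat_norm1 A = (SUP x\<in>{x. x \<noteq> 0}. vec_norm1 (A *v x) / vec_norm1 x)"

(* A real supremum is only meaningful for a nonempty set that is bounded above; the next
   lemmas confirm this here and give the maximum absolute column sum as its value. *)

lemma vec_norm1_mult_le:
  fixes A :: "'a::real_normed_field ^ 'n ^ 'm"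
  shows "vec_norm1 (A *v x) \<le> (MAX j. vec_norm1 (column j A)) * vec_norm1 x"
proof -
  have "vec_norm1 (A *v x) \<le> (\<Sum>i\<in>UNIV. \<Sum>j\<in>UNIV. norm (A $ i $ j) * norm (x $ j))"
    unfolding vec_norm1_def matrix_vector_mult_def
    by (auto intro!: sum_mono sum_norm_le simp: norm_mult)
  also have "\<dots> = (\<Sum>j\<in>UNIV. vec_norm1 (column j A) * norm (x $ j))"
    unfolding vec_norm1_def column_def by (subst sum.swap) (simp add: sum_distrib_right)
  also have "\<dots> \<le> (\<Sum>j\<in>UNIV. (MAX j. vec_norm1 (column j A)) * norm (x $ j))"
    by (intro sum_mono mult_right_mono Max_ge) auto
  finally show ?thesis
    by (simp add: vec_norm1_def sum_distrib_left)
qed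

lemma mat_norm1_eq_Max_column:
  fixes A :: "'a::real_normed_field ^ 'n ^ 'm"
  shows "bdd_above ((\<lambda>x. vec_norm1 (A *v x) / vec_norm1 x) ` {x. x \<noteq> 0})"
    and "mat_norm1 A = (MAX j. vec_norm1 (column j A))"
proof -
  let ?M = "MAX j. vec_norm1 (column j A)"
  have le: "vec_norm1 (A *v x) / vec_norm1 x \<le> ?M" if "x \<noteq> 0" for x
  proof -
    have "vec_norm1 x \<ge> 0" by (simp add: vec_norm1_def sum_nonneg)
    moreover have "vec_norm1 x \<noteq> 0"
      using that by (auto simp: vec_norm1_def sum_nonneg_eq_0_iff vec_eq_iff)
    ultimately have "vec_norm1 x > 0" by simp
    with vec_norm1_mult_le[of A x] show ?thesis by (simp add: field_simps)
  qed
  then show "bdd_above ((\<lambda>x. vec_norm1 (A *v x) / vec_norm1 x) ` {x. x \<noteq> 0})"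
    by (intro bdd_aboveI2) auto
  have "?M \<in> range (\<lambda>j. vec_norm1 (column j A))"
    by (intro Max_in) auto
  then obtain j where j: "?M = vec_norm1 (column j A)" by blast
  have e: "vec_norm1 (axis j 1 :: 'a ^ 'n) = 1"
    by (simp add: vec_norm1_def axis_def if_distrib cong: if_cong)
  have ne: "(axis j 1 :: 'a ^ 'n) \<noteq> 0"
    by (simp add: axis_eq_0_iff)
  have col: "A *v axis j 1 = column j A"
    by (simp add: vec_eq_iff matrix_vector_mult_def column_def axis_def if_distrib cong: if_cong)
  show "mat_norm1 A = ?M"
    unfolding mat_norm1_def
  proof (rule cSup_eq_maximum)
    show "?M \<in> (\<lambda>x. vec_norm1 (A *v x) / vec_norm1 x) ` {x. x \<noteq> 0}"
      using ne e j col by (intro image_eqI[of _ _ "axis j 1"]) auto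
  qed (use le in auto)
qed

end

theory Submission
  imports Defs
begin

text \<open>By linearity, dropping the column f of \<open>F\<close> changes the residual by exactly
  \<open>A *v f\<close>. The Euclidean norm is dominated by the 1-norm, with which
  \<open>mat_norm1\<close> is consistent, so \<open>norm_mult_le_mat_norm1\<close> together with the
  bound on f limits this change to \<epsilon>. The triangle inequality adds it to the original
  residual, itself at most \<epsilon>.\<close>

lemma norm_le_vec_norm1: "norm x \<le> vec_norm1 x"
  unfolding norm_vec_def vec_norm1_def by (rule L2_set_le_sum) simp

lemma vec_norm1_nonneg: "0 \<le> vec_norm1 x"
  by (simp add: vec_norm1_def sum_nonneg)

lemma mat_norm1_nonneg: "0 \<le> mat_norm1 A"
  by (simp add: mat_norm1_eq_Max_column(2) Max_ge_iff vec_norm1_nonneg)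

text \<open>Bridges the two norms: the residual is measured in the 2-norm, the dropped column in the
  1-norm.\<close>

lemma norm_mult_le_mat_norm1: "norm (A *v x) \<le> mat_norm1 A * vec_norm1 x"
  using norm_le_vec_norm1 vec_norm1_mult_le
  unfolding mat_norm1_eq_Max_column(2) by (rule order_trans)

theorem theorem3p4:
  fixes A M F M_d :: "'a::real_normed_field ^ 'n ^ 'n"
    and \<epsilon> :: real
  assumes "invertible A"
    and "\<And>k. norm (A *v column k M - axis k 1) \<le> \<epsilon>"
    and "\<epsilon> < 0.5"
    and "M_d = M - F"
    and "\<And>k. vec_norm1 (column k F) \<le> \<epsilon> / mat_norm1 A"
  shows "\<forall>k. norm (A *v column k M_d - axis k 1) \<le> 2 * \<epsilon>"
proof
  fix k
  have "\<epsilon> \<ge> 0"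
    using assms(2)[of k] norm_ge_zero order_trans by blast
  have "norm (A *v column k F) \<le> mat_norm1 A * vec_norm1 (column k F)"
    by (rule norm_mult_le_mat_norm1)
  also have "\<dots> \<le> mat_norm1 A * (\<epsilon> / mat_norm1 A)"
    by (intro mult_left_mono assms(5) mat_norm1_nonneg)
  \<comment> \<open>An inequality suffices and covers both cases: the product is \<epsilon> when
    \<open>mat_norm1 A\<close> is nonzero and 0 otherwise, hence the appeal to \<epsilon> \<ge>
    0.\<close>
  also have "\<dots> \<le> \<epsilon>"
    using \<open>\<epsilon> \<ge> 0\<close> by simp
  finally have F: "norm (A *v column k F) \<le> \<epsilon>" .
  have "column k M_d = column k M - column k F"
    by (simp add: assms(4) column_def vec_eq_iff)
  then have "A *v column k M_d - axis k 1 = (A *v column k M - axis k 1) - A *v column k F"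
    by (simp add: matrix_vector_mult_diff_distrib)
  then have "norm (A *v column k M_d - axis k 1)
      \<le> norm (A *v column k M - axis k 1) + norm (A *v column k F)"
    by (simp only: norm_triangle_ineq4)
  with F assms(2)[of k] show "norm (A *v column k M_d - axis k 1) \<le> 2 * \<epsilon>"
    by simp
qed

end
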